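(* For integers $k\geq1$, $p\geq2$ and any integer $m$, \begin{align*} &\sum_{n=0}^\infty(-1)^{\lfloor n/k\rfloor}\frac{F_{n+m}}{p^{n+1}}\\ &=\frac{(p^{2k}-(-1)^k)(pF_m+F_{m-1})-p^k(pF_{k+m}+F_{k+m-1})+(-1)^mp^k(F_{k-m+1}-pF_{k-m})}{(p^2-p-1)\big(p^{2k}+p^kL_k+(-1)^k\big)}, \end{align*} and \begin{align*} &\sum_{n=0}^\infty(-1)^{\lfloor n/k\rfloor}\frac{L_{n+m}}{p^{n+1}}\\ &=\frac{(p^{2k}-(-1)^k)(pL_m+L_{m-1})-p^k(pL_{k+m}+L_{k+m-1})-(-1)^mp^k(L_{k-m+1}-pL_{k-m})}{(p^2-p-1)\big(p^{2k}+p^kL_k+(-1)^k\big)}. \end{align*}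
   Context: $F_n$ and $L_n$ are the Fibonacci and Lucas numbers ($F_0=0,F_1=1$, $L_0=2,L_1=1$, $X_n=X_{n-1}+X_{n-2}$), extended to negative indices by $F_{-n}=(-1)^{n-1}F_n$, $L_{-n}=(-1)^nL_n$. $\lfloor x\rfloor$ is the floor function. *)

theory Defs
  imports "HOL-Analysis.Analysis" "HOL-Number_Theory.Fib"
begin

fun lucas :: "nat \<Rightarrow> nat" where
  "lucas 0 = 2"
| "lucas (Suc 0) = 1"
| "lucas (Suc (Suc n)) = lucas (Suc n) + lucas n"

definition fib_int :: "int \<Rightarrow> int" where
  "fib_int n = (if n \<ge> 0 then int (fib (nat n))
                else (- 1) ^ nat (- n - 1) * int (fib (nat (- n))))"

definition lucas_int :: "int \<Rightarrow> int" where
  "lucas_int n = (if n \<ge> 0 then int (lucas (nat n))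
                  else (- 1) ^ nat (- n) * int (lucas (nat (- n))))"

lemma fib_int_of_nat [simp]: "fib_int (int n) = int (fib n)"
  by (simp add: fib_int_def)

lemma lucas_int_of_nat [simp]: "lucas_int (int n) = int (lucas n)"
  by (simp add: lucas_int_def)

lemma fib_int_minus: "n > 0 \<Longrightarrow> fib_int (- int n) = (- 1) ^ (n - 1) * int (fib n)"
  by (simp add: fib_int_def nat_diff_distrib)

lemma lucas_int_minus: "lucas_int (- int n) = (- 1) ^ n * int (lucas n)"
  by (simp add: lucas_int_def)

end

theory Submission
  imports Defs
begin

text \<open>
  For \<open>r = a / p\<close> with \<open>a\<close> a root of \<open>x^2 = x + 1\<close>, the signed geometric series
  \<open>S = \<Sum>n. (-1)^(n div k) * r^n\<close> satisfies \<open>S = (1 + \<dots> + r^(k-1)) - r^k * S\<close>.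
  Multiplying numerator and denominator of the resulting closed form by the conjugate
  factors \<open>(p - b) * (p^k + b^k)\<close>, \<open>b = 1 - a = - 1 / a\<close>, makes the denominator the same for both
  roots, and Binet's formulas on all integers combine the two series.
\<close>

lemma signed_geometric_sums:
  fixes r :: real
  assumes "k \<ge> 1" and r: "\<bar>r\<bar> < 1"
  shows "(\<lambda>n. (- 1) ^ (n div k) * r ^ n) sums ((1 - r ^ k) / ((1 - r) * (1 + r ^ k)))"
proof -
  define f where "f n = (- 1) ^ (n div k) * r ^ n" for n
  have rk: "\<bar>r ^ k\<bar> < 1"
    using assms by (simp add: power_abs power_less_one_iff)
  have summable: "summable f"
    by (rule summable_comparison_test'[of "\<lambda>n. \<bar>r\<bar> ^ n" 0])
       (use r in \<open>auto simp: f_def abs_mult power_abs\<close>)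
  \<comment> \<open>Adding \<open>k\<close> to \<open>n\<close> raises \<open>n div k\<close> by
    exactly one, which flips the sign. On the initial block \<open>n < k\<close> the quotient is 0,
    so no signs occur there.\<close>
  have shift: "f (n + k) = - (r ^ k) * f n" for n
    using assms(1) by (simp add: f_def power_add)
  have "suminf f = (\<Sum>n. f (n + k)) + (\<Sum>n<k. f n)"
    by (rule suminf_split_initial_segment[OF summable])
  also have "(\<Sum>n. f (n + k)) = - (r ^ k) * suminf f"
    unfolding shift by (rule suminf_mult[OF summable])
  also have "(\<Sum>n<k. f n) = (\<Sum>n<k. r ^ n)"
    by (rule sum.cong) (auto simp: f_def)
  also have "\<dots> = (1 - r ^ k) / (1 - r)"
    using r by (subst sum_gp_strict) auto
  finally have "suminf f - - (r ^ k) * suminf f = (1 - r ^ k) / (1 - r)"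
    by linarith
  then have "suminf f * (1 + r ^ k) = (1 - r ^ k) / (1 - r)"
    by (simp add: distrib_left mult.commute)
  moreover have "1 + r ^ k \<noteq> 0"
    using rk by linarith
  ultimately have "suminf f = (1 - r ^ k) / (1 - r) / (1 + r ^ k)"
    by (metis nonzero_mult_div_cancel_right)
  then show ?thesis
    using summable_sums[OF summable] by (simp flip: f_def)
qed

text \<open>The limit is deliberately left unreduced: its denominator is symmetric in
  \<open>a\<close> and \<open>b\<close>, so the series of the two roots share it. Writing the last
  summand in powers of \<open>b\<close> brings in the exponents \<open>k - m\<close> of the target
  formulas.\<close>

lemma signed_power_sums:
  fixes a b p :: real and k :: nat and m :: int
  assumes k: "k \<ge> 1" and sum: "a + b = 1" and prod: "a * b = - 1"
    and ap: "\<bar>a\<bar> < p" and bp: "\<bar>b\<bar> < p"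
  shows "(\<lambda>n. (- 1) powi \<lfloor>real n / real k\<rfloor> * a powi (int n + m) / p ^ (n + 1)) sums
    (((p ^ (2 * k) - (- 1) ^ k) * (p * a powi m + a powi (m - 1))
        - p ^ k * (p * a powi (int k + m) + a powi (int k + m - 1))
        - (- 1) powi m * p ^ k * (b powi (int k - m + 1) - p * b powi (int k - m)))
      / ((p ^ 2 - p - 1) * (p ^ (2 * k) + p ^ k * (a ^ k + b ^ k) + (- 1) ^ k)))"
    (is "_ sums (?N / ?D)")
proof -
  have nz: "a \<noteq> 0" "b \<noteq> 0" "p > 0"
    using prod ap by auto
  \<comment> \<open>For \<open>c = b\<close> this lets the conjugate factors be cancelled.\<close>
  have pos: "p ^ k + c ^ k > 0" "p - c > 0" if "\<bar>c\<bar> < p" for c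
  proof -
    have "\<bar>c ^ k\<bar> < p ^ k"
      using that k by (simp add: power_abs power_strict_mono)
    then show "p ^ k + c ^ k > 0" "p - c > 0" using that by auto
  qed
  have abk: "a ^ k * b ^ k = (- 1) ^ k"
    by (metis power_mult_distrib prod)
  have am: "a powi m * b powi m = (- 1) powi m"
    by (metis power_int_mult_distrib prod)
  have inv: "x / a = - b * x" for x
  proof -
    have "inverse a = - b"
      using prod by (intro inverse_unique) simp
    then show ?thesis
      by (simp add: divide_inverse)
  qed
  \<comment> \<open>From here on every power is reduced to \<open>a powi m\<close>,
    \<open>a ^ k\<close> and \<open>b ^ k\<close>, so that the numerator becomes a polynomial
    expression.\<close>
  have a1: "a powi (m - 1) = - b * a powi m"
    using nz inv by (simp add: power_int_diff)
  have ak: "a powi (int k + m) = a ^ k * a powi m"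
    using nz by (simp add: power_int_add)
  have ak1: "a powi (int k + m - 1) = - b * a ^ k * a powi m"
    using nz inv by (simp add: power_int_diff power_int_add)
  \<comment> \<open>Since \<open>(- 1) powi m\<close> is \<open>a powi m * b powi m\<close>, the
    negative part of the exponent of \<open>b\<close> cancels.\<close>
  have bk: "(- 1) powi m * b powi (int k - m) = a powi m * b ^ k"
    using nz by (simp add: power_int_diff flip: am)
  have bk1: "(- 1) powi m * b powi (int k - m + 1) = b * a powi m * b ^ k"
    using nz by (simp add: power_int_add mult_ac flip: bk)
  have D: "?D = ((p - a) * (p ^ k + a ^ k)) * ((p - b) * (p ^ k + b ^ k))"
  proof -
    have "(p - a) * (p - b) = p ^ 2 - (a + b) * p + a * b"
      by (simp add: algebra_simps power2_eq_square)
    then have 1: "(p - a) * (p - b) = p ^ 2 - p - 1"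
      by (simp add: sum prod)
    have 2: "(p ^ k + a ^ k) * (p ^ k + b ^ k) = p ^ (2 * k) + p ^ k * (a ^ k + b ^ k) + (- 1) ^ k"
      by (simp add: algebra_simps mult_2 mult_2_right power_add flip: abk)
    show ?thesis
      unfolding 1[symmetric] 2[symmetric] by (simp add: mult_ac)
  qed
  have "?N = (p ^ k * p ^ k - a ^ k * b ^ k) * (p * a powi m - b * a powi m)
      - p ^ k * (p * (a ^ k * a powi m) - b * a ^ k * a powi m)
      - p ^ k * ((- 1) powi m * b powi (int k - m + 1) - p * ((- 1) powi m * b powi (int k - m)))"
    unfolding a1 ak ak1 abk by (simp add: mult_2 mult_2_right power_add algebra_simps)
  \<comment> \<open>Pull out \<open>a powi m * (p - b)\<close>; what remains is
    \<open>p^(2k) - p^k a^k + p^k b^k - a^k b^k\<close>, which splits as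
    \<open>(p^k - a^k) (p^k + b^k)\<close>.\<close>
  also have "\<dots> = (a powi m * (p ^ k - a ^ k)) * ((p - b) * (p ^ k + b ^ k))"
    unfolding bk bk1 by (simp add: algebra_simps)
  finally have val: "?N / ?D = a powi m * (p ^ k - a ^ k) / ((p - a) * (p ^ k + a ^ k))"
    unfolding D using pos[OF bp] by simp
  have "\<bar>a / p\<bar> < 1"
    using ap nz by simp
  from signed_geometric_sums[OF k this]
  have "(\<lambda>n. a powi m / p * ((- 1) ^ (n div k) * (a / p) ^ n)) sums
      (a powi m / p * ((1 - (a / p) ^ k) / ((1 - a / p) * (1 + (a / p) ^ k))))"
    by (rule sums_mult)
  also have "(\<lambda>n. a powi m / p * ((- 1) ^ (n div k) * (a / p) ^ n)) =
      (\<lambda>n. (- 1) powi \<lfloor>real n / real k\<rfloor> * a powi (int n + m) / p ^ (n + 1))"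
    using nz by (intro ext) (simp add: floor_divide_of_nat_eq power_int_add power_divide)
  also have "a powi m / p * ((1 - (a / p) ^ k) / ((1 - a / p) * (1 + (a / p) ^ k))) = ?N / ?D"
  proof -
    have "1 - (a / p) ^ k = (p ^ k - a ^ k) / p ^ k" "1 + (a / p) ^ k = (p ^ k + a ^ k) / p ^ k"
      "1 - a / p = (p - a) / p"
      using nz by (simp_all add: power_divide field_simps)
    then show ?thesis
      unfolding val using nz by simp
  qed
  finally show ?thesis .
qed

definition golden :: real where "golden = (1 + sqrt 5) / 2"

definition golden_conj :: real where "golden_conj = (1 - sqrt 5) / 2"

lemma golden_simps:
  "golden + golden_conj = 1" "golden * golden_conj = - 1"
  "golden ^ 2 = golden + 1" "golden_conj ^ 2 = golden_conj + 1"
  by (simp_all add: golden_def golden_conj_def field_simps power2_eq_square)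

text \<open>The bound 2 is the smallest admissible \<open>p\<close>, so both ratios root /
  \<open>p\<close> lie inside the unit interval.\<close>

lemma golden_abs_less: "\<bar>golden\<bar> < 2" "\<bar>golden_conj\<bar> < 2"
proof -
  have "sqrt 5 < 3" "sqrt 5 > 0"
    by (simp_all add: real_less_lsqrt)
  then show "\<bar>golden\<bar> < 2" "\<bar>golden_conj\<bar> < 2"
    by (auto simp: golden_def golden_conj_def)
qed

text \<open>The product of the roots is -1, so inverting one gives minus the other: negative
  exponents exchange the roots.\<close>

lemma golden_power_minus:
  "golden powi (- int n) = (- 1) ^ n * golden_conj ^ n"
  "golden_conj powi (- int n) = (- 1) ^ n * golden ^ n"
proof -
  have "inverse golden = - golden_conj" "inverse golden_conj = - golden"
    by (rule inverse_unique, simp add: golden_simps mult.commute)+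
  then show "golden powi (- int n) = (- 1) ^ n * golden_conj ^ n"
    "golden_conj powi (- int n) = (- 1) ^ n * golden ^ n"
    by (simp_all add: power_int_minus flip: power_inverse power_mult_distrib)
qed

lemma fib_binet: "real (fib n) = (golden ^ n - golden_conj ^ n) / sqrt 5"
  unfolding golden_def golden_conj_def by (rule fib_closed_form)

lemma lucas_binet: "real (lucas n) = golden ^ n + golden_conj ^ n"
proof (induction n rule: lucas.induct)
  case (3 n)
  have "x ^ Suc (Suc n) = x ^ Suc n + x ^ n" if "x ^ 2 = x + 1" for x :: real
  proof -
    have "x ^ Suc (Suc n) = x ^ 2 * x ^ n" by (simp add: power2_eq_square)
    then show ?thesis unfolding that by (simp add: distrib_right)
  qed
  from this[OF golden_simps(3)] this[OF golden_simps(4)] 3 show ?case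
    by (simp del: power_Suc)
qed (use golden_simps in auto)

text \<open>At negative indices the exchange of roots reverses the difference; this extra sign
  matches the exponent \<open>- n - 1\<close> in \<open>fib_int\<close>. The Lucas sum is symmetric
  and gets none.\<close>

lemma fib_int_binet: "real_of_int (fib_int n) = (golden powi n - golden_conj powi n) / sqrt 5"
proof (cases n)
  case (nonneg j)
  then show ?thesis by (simp add: fib_binet)
next
  case (neg j)
  then show ?thesis
    unfolding neg golden_power_minus
    by (simp add: fib_int_minus fib_binet right_diff_distrib del: fib.simps flip: of_nat_Suc)
qed

lemma lucas_int_binet: "real_of_int (lucas_int n) = golden powi n + golden_conj powi n"
proof (cases n)
  case (nonneg j)
  then show ?thesis by (simp add: lucas_binet)
next
  case (neg j)
  then show ?thesis
    unfolding neg golden_power_minus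
    by (simp add: lucas_int_minus lucas_binet distrib_left add.commute del: power_Suc lucas.simps of_nat_Suc)
qed

theorem theorem33:
  fixes k :: nat and p m :: int
  assumes "k \<ge> 1" and "p \<ge> 2"
  shows
    "((\<lambda>n::nat. (- 1) powi \<lfloor>real n / real k\<rfloor> * real_of_int (fib_int (int n + m)) / real_of_int p ^ (n + 1))
     sums
     (((real_of_int p ^ (2 * k) - (- 1) ^ k) * (real_of_int p * real_of_int (fib_int m) + real_of_int (fib_int (m - 1)))
        - real_of_int p ^ k * (real_of_int p * real_of_int (fib_int (int k + m)) + real_of_int (fib_int (int k + m - 1)))
        + (- 1) powi m * real_of_int p ^ k
            * (real_of_int (fib_int (int k - m + 1)) - real_of_int p * real_of_int (fib_int (int k - m))))
      / ((real_of_int p ^ 2 - real_of_int p - 1)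
          * (real_of_int p ^ (2 * k) + real_of_int p ^ k * real_of_int (lucas_int (int k)) + (- 1) ^ k))))
     \<and>
     ((\<lambda>n::nat. (- 1) powi \<lfloor>real n / real k\<rfloor> * real_of_int (lucas_int (int n + m)) / real_of_int p ^ (n + 1))
     sums
     (((real_of_int p ^ (2 * k) - (- 1) ^ k) * (real_of_int p * real_of_int (lucas_int m) + real_of_int (lucas_int (m - 1)))
        - real_of_int p ^ k * (real_of_int p * real_of_int (lucas_int (int k + m)) + real_of_int (lucas_int (int k + m - 1)))
        - (- 1) powi m * real_of_int p ^ k
            * (real_of_int (lucas_int (int k - m + 1)) - real_of_int p * real_of_int (lucas_int (int k - m))))
      / ((real_of_int p ^ 2 - real_of_int p - 1)
          * (real_of_int p ^ (2 * k) + real_of_int p ^ k * real_of_int (lucas_int (int k)) + (- 1) ^ k))))"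
proof -
  define P where "P = real_of_int p"
  have P: "\<bar>golden\<bar> < P" "\<bar>golden_conj\<bar> < P"
    using golden_abs_less assms(2) by (auto simp: P_def)
  note G = signed_power_sums[OF assms(1) golden_simps(1,2) P, of m]
  note C = signed_power_sums[OF assms(1) _ _ P(2,1), of m]
  have swap: "golden_conj + golden = 1" "golden_conj * golden = - 1"
    using golden_simps by (simp_all add: add.commute mult.commute)
  \<comment> \<open>Reordering \<open>golden_conj ^ k + golden ^ k\<close> makes the denominators of
    \<open>G\<close> and \<open>C\<close> syntactically equal.\<close>
  note C = C[OF swap, unfolded add.commute[of "golden_conj ^ k"]]
  have sums_eq: "g sums t" if "f sums s" "\<And>n. g n = f n" "t = s" for f g :: "nat \<Rightarrow> real" and s t
    using that by (metis ext)
  \<comment> \<open>Here \<open>x1\<close>, ..., \<open>x6\<close> stand for powers of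
    \<open>golden\<close>, \<open>y1\<close>, ..., \<open>y6\<close> for those of
    \<open>golden_conj\<close>, and \<open>c\<close> for \<open>1 / sqrt 5\<close>. In the last
    group the roots are crossed, so subtracting the series turns \<open>- s * B\<close> into
    \<open>+ s * B\<close>, whereas adding them keeps the minus sign. This is why the Fibonacci and
    Lucas formulas differ there.\<close>
  have fib_limit: "(A * (q * (c * (x1 - y1)) + c * (x2 - y2)) - B * (q * (c * (x3 - y3)) + c * (x4 - y4))
        + s * B * (c * (x5 - y5) - q * (c * (x6 - y6)))) / d
      = c * ((A * (q * x1 + x2) - B * (q * x3 + x4) - s * B * (y5 - q * y6)) / d
           - (A * (q * y1 + y2) - B * (q * y3 + y4) - s * B * (x5 - q * x6)) / d)"
    for A B c d q s x1 x2 x3 x4 x5 x6 y1 y2 y3 y4 y5 y6 :: real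
    by (subst diff_divide_distrib[symmetric], subst times_divide_eq_right, rule arg_cong[where f = "\<lambda>t. t / d"])
       (simp add: algebra_simps)
  have lucas_limit: "(A * (q * (x1 + y1) + (x2 + y2)) - B * (q * (x3 + y3) + (x4 + y4))
        - s * B * ((x5 + y5) - q * (x6 + y6))) / d
      = (A * (q * x1 + x2) - B * (q * x3 + x4) - s * B * (y5 - q * y6)) / d
      + (A * (q * y1 + y2) - B * (q * y3 + y4) - s * B * (x5 - q * x6)) / d"
    for A B d q s x1 x2 x3 x4 x5 x6 y1 y2 y3 y4 y5 y6 :: real
    by (subst add_divide_distrib[symmetric], rule arg_cong[where f = "\<lambda>t. t / d"])
       (simp add: algebra_simps)
  have fib_term: "e * (c * (x - y)) / d = c * (e * x / d - e * y / d)"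
    and lucas_term: "e * (x + y) / d = e * x / d + e * y / d" for c d e x y :: real
    by (simp_all add: diff_divide_distrib add_divide_distrib right_diff_distrib distrib_left mult.left_commute)
  have binet: "real_of_int (fib_int n) = inverse (sqrt 5) * (golden powi n - golden_conj powi n)" for n
    by (simp add: fib_int_binet field_simps)
  \<comment> \<open>Unfolding also rewrites the Lucas number in the denominator as
    \<open>golden ^ k + golden_conj ^ k\<close>, as in \<open>G\<close> and
    \<open>C\<close>.\<close>
  show ?thesis
    unfolding P_def[symmetric] binet lucas_int_binet power_int_of_nat
    by (intro conjI sums_eq[OF sums_mult[OF sums_diff[OF G C]] fib_term fib_limit]
        sums_eq[OF sums_add[OF G C] lucas_term lucas_limit])
qed

end
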